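(* Let $k\ge1$ and $n-2k\ge4$. For $a_2,\dots,a_{n-2k+1}\in\mathbb{C}$ let $R(\mu_1,1)(a_2,\dots,a_{n-2k+1})$ be the $(n+1)$-dimensional Leibniz algebra over $\mathbb{C}$ with basis $\{e_1,\dots,e_{n-2k},f_1,\dots,f_{2k},x\}$ and multiplication table $$\begin{array}{ll} [e_i,e_1]=e_{i+1},&1\le i\le n-2k-1,\\ {}[e_1,f_i]=f_{k+i},&1\le i\le k,\\ {}[e_i,x]=\sum_{j=i+1}^{n-2k}a_{j-i+1}e_j,&1\le i\le n-2k,\\ {}[f_i,x]=f_i+f_{i+1},&1\le i\le k-1,\\ {}[f_k,x]=f_k,&\\ {}[f_i,x]=f_i+f_{i+1},&k+1\le i\le 2k-1,\\ {}[f_{2k},x]=f_{2k},&\\ {}[x,f_i]=-f_i-f_{i+1},&1\le i\le k-1,\\ {}[x,f_k]=-f_k,&\\ {}[x,x]=a_{n-2k+1}e_{n-2k},& \end{array}$$ products not listed being zero. Then the algebras $R(\mu_1,1)(a_2',\dots,a_{n-2k+1}')$ and $R(\mu_1,1)(a_2,\dots,a_{n-2k+1})$ are isomorphic if and only if there exists $A\in\mathbb{C}\setminus\{0\}$ such that $$a_i'=\frac{a_i}{A^{i-1}},\qquad 2\le i\le n-2k+1.$$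
   Context: A (right) Leibniz algebra is a vector space $L$ over $\mathbb{C}$ with a bilinear bracket satisfying $[x,[y,z]]=[[x,y],z]-[[x,z],y]$ for all $x,y,z\in L$. An isomorphism is a bijective linear map preserving the bracket. An empty sum is $0$. *)

theory Defs
  imports Complex_Main "HOL-Library.Function_Algebras"
begin

text \<open>
  An algebra is carried by a subspace \<open>carr\<close> of an ambient complex vector space, whose scalar
  multiplication is \<open>scl\<close>; outside \<open>carr\<close> the bracket is irrelevant.
\<close>

record 'v bracket_algebra =
  scl :: "complex \<Rightarrow> 'v \<Rightarrow> 'v"
  carr :: "'v set"
  brk :: "'v \<Rightarrow> 'v \<Rightarrow> 'v"

definition bilinear_bracket :: "'v::ab_group_add bracket_algebra \<Rightarrow> bool" where
  "bilinear_bracket L \<longleftrightarrow>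
     vector_space (scl L) \<and> module.subspace (scl L) (carr L) \<and>
     (\<forall>u\<in>carr L. \<forall>v\<in>carr L. brk L u v \<in> carr L) \<and>
     (\<forall>u\<in>carr L. \<forall>v\<in>carr L. \<forall>w\<in>carr L.
        brk L (u + v) w = brk L u w + brk L v w \<and>
        brk L u (v + w) = brk L u v + brk L u w) \<and>
     (\<forall>c. \<forall>u\<in>carr L. \<forall>v\<in>carr L.
        brk L (scl L c u) v = scl L c (brk L u v) \<and>
        brk L u (scl L c v) = scl L c (brk L u v))"

definition leibniz_algebra :: "'v::ab_group_add bracket_algebra \<Rightarrow> bool" where
  "leibniz_algebra L \<longleftrightarrow>
     bilinear_bracket L \<and>
     (\<forall>u\<in>carr L. \<forall>v\<in>carr L. \<forall>w\<in>carr L.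
        brk L u (brk L v w) = brk L (brk L u v) w - brk L (brk L u w) v)"

definition algebra_iso ::
  "('v::ab_group_add \<Rightarrow> 'w::ab_group_add) \<Rightarrow> 'v bracket_algebra \<Rightarrow> 'w bracket_algebra \<Rightarrow> bool" where
  "algebra_iso \<phi> L M \<longleftrightarrow>
     bij_betw \<phi> (carr L) (carr M) \<and>
     (\<forall>u\<in>carr L. \<forall>v\<in>carr L. \<phi> (u + v) = \<phi> u + \<phi> v) \<and>
     (\<forall>c. \<forall>u\<in>carr L. \<phi> (scl L c u) = scl M c (\<phi> u)) \<and>
     (\<forall>u\<in>carr L. \<forall>v\<in>carr L. \<phi> (brk L u v) = brk M (\<phi> u) (\<phi> v))"

definition isomorphic_algebras ::
  "'v::ab_group_add bracket_algebra \<Rightarrow> 'w::ab_group_add bracket_algebra \<Rightarrow> bool" where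
  "isomorphic_algebras L M \<longleftrightarrow> (\<exists>\<phi>. algebra_iso \<phi> L M)"

text \<open>
  The ambient space for all parameters is the space of functions \<open>basis_index \<Rightarrow> complex\<close>;
  the indices \<open>E i\<close>, \<open>F i\<close>, \<open>X\<close> stand for the basis vectors \<open>e\<^sub>i\<close>, \<open>f\<^sub>i\<close>, \<open>x\<close>, and
  \<open>basis_set n k\<close> is the set of those that belong to the algebra with parameters \<open>n\<close> and \<open>k\<close>.
\<close>

datatype basis_index = E nat | F nat | X

definition basis_set :: "nat \<Rightarrow> nat \<Rightarrow> basis_index set" where
  "basis_set n k = E ` {1..n - 2*k} \<union> F ` {1..2*k} \<union> {X}"

definition smul :: "complex \<Rightarrow> (basis_index \<Rightarrow> complex) \<Rightarrow> (basis_index \<Rightarrow> complex)" where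
  "smul c v = (\<lambda>b. c * v b)"

definition bvec :: "basis_index \<Rightarrow> (basis_index \<Rightarrow> complex)" where
  "bvec b = (\<lambda>b'. if b' = b then 1 else 0)"

fun mult_table ::
  "nat \<Rightarrow> nat \<Rightarrow> (nat \<Rightarrow> complex) \<Rightarrow> basis_index \<Rightarrow> basis_index \<Rightarrow> (basis_index \<Rightarrow> complex)" where
  "mult_table n k a (E i) (E j) =
     (if 1 \<le> i \<and> i \<le> n - 2*k - 1 \<and> j = 1 then bvec (E (i + 1)) else 0)"
| "mult_table n k a (E i) (F j) =
     (if i = 1 \<and> 1 \<le> j \<and> j \<le> k then bvec (F (k + j)) else 0)"
| "mult_table n k a (E i) X =
     (if 1 \<le> i \<and> i \<le> n - 2*k then \<Sum>j=i+1..n-2*k. smul (a (j - i + 1)) (bvec (E j)) else 0)"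
| "mult_table n k a (F i) X =
     (if 1 \<le> i \<and> i \<le> k - 1 then bvec (F i) + bvec (F (i + 1))
      else if i = k then bvec (F k)
      else if k + 1 \<le> i \<and> i \<le> 2*k - 1 then bvec (F i) + bvec (F (i + 1))
      else if i = 2*k then bvec (F (2*k))
      else 0)"
| "mult_table n k a X (F i) =
     (if 1 \<le> i \<and> i \<le> k - 1 then - bvec (F i) - bvec (F (i + 1))
      else if i = k then - bvec (F k)
      else 0)"
| "mult_table n k a X X = smul (a (n - 2*k + 1)) (bvec (E (n - 2*k)))"
| "mult_table n k a (F i) (E j) = 0"
| "mult_table n k a (F i) (F j) = 0"
| "mult_table n k a X (E j) = 0"

text \<open>
  Only the values \<open>a i\<close> with \<open>2 \<le> i \<le> n - 2 * k + 1\<close> enter the definition of \<open>R_mu1 n k a\<close>.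
\<close>

definition R_mu1 ::
  "nat \<Rightarrow> nat \<Rightarrow> (nat \<Rightarrow> complex) \<Rightarrow> (basis_index \<Rightarrow> complex) bracket_algebra" where
  "R_mu1 n k a = \<lparr>
     scl = smul,
     carr = {v. \<forall>b. b \<notin> basis_set n k \<longrightarrow> v b = 0},
     brk = (\<lambda>u v. \<Sum>b\<in>basis_set n k. \<Sum>b'\<in>basis_set n k. smul (u b * v b') (mult_table n k a b b')) \<rparr>"

text \<open>
  The remaining facts show that \<open>R_mu1 n k a\<close> is a Leibniz algebra with the expected basis
  and multiplication table.
\<close>

interpretation fun_vs: vector_space smul
  by unfold_locales (auto simp: smul_def algebra_simps fun_eq_iff)

lemma finite_basis_set [simp]: "finite (basis_set n k)"
  by (simp add: basis_set_def)

lemma card_basis_set: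
  assumes "2*k \<le> n"
  shows "card (basis_set n k) = n + 1"
proof -
  have "card (E ` {1..n - 2*k} \<union> F ` {1..2*k}) = n"
    using assms by (subst card_Un_disjoint) (auto simp: card_image inj_on_def)
  thus ?thesis
    unfolding basis_set_def by (subst card_Un_disjoint) auto
qed

lemma sum_fun_at: "(\<Sum>i\<in>A. (f i :: basis_index \<Rightarrow> complex)) b = (\<Sum>i\<in>A. f i b)"
  by (induction A rule: infinite_finite_induct) auto

lemma smul_at: "smul c v b = c * v b"
  by (simp add: smul_def)

lemma bvec_at: "bvec b c = (if c = b then 1 else 0)"
  by (simp add: bvec_def)

lemma bvec_expand:
  assumes "finite B" "\<forall>b. b \<notin> B \<longrightarrow> v b = 0"
  shows "v = (\<Sum>b\<in>B. smul (v b) (bvec b))"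
proof
  fix c
  have "(\<Sum>b\<in>B. smul (v b) (bvec b)) c = (\<Sum>b\<in>B. if c = b then v b else 0)"
    by (auto simp: sum_fun_at smul_at bvec_def intro!: sum.cong)
  also have "\<dots> = v c" using assms by simp
  finally show "v c = (\<Sum>b\<in>B. smul (v b) (bvec b)) c" by simp
qed

lemma inj_bvec: "inj bvec"
proof (rule injI)
  fix b c assume "bvec b = bvec c"
  hence "bvec b b = bvec c b" by simp
  thus "b = c" by (simp add: bvec_def split: if_splits)
qed

lemma R_mu1_carr_span: "carr (R_mu1 n k a) = fun_vs.span (bvec ` basis_set n k)"
proof
  show "carr (R_mu1 n k a) \<subseteq> fun_vs.span (bvec ` basis_set n k)"
  proof
    fix v assume "v \<in> carr (R_mu1 n k a)"
    hence "v = (\<Sum>b\<in>basis_set n k. smul (v b) (bvec b))"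
      by (intro bvec_expand) (auto simp: R_mu1_def)
    also have "\<dots> \<in> fun_vs.span (bvec ` basis_set n k)"
      by (intro fun_vs.span_sum fun_vs.span_scale fun_vs.span_base) auto
    finally show "v \<in> fun_vs.span (bvec ` basis_set n k)" .
  qed
  have "fun_vs.subspace (carr (R_mu1 n k a))"
    by (auto simp: fun_vs.subspace_def R_mu1_def smul_def)
  thus "fun_vs.span (bvec ` basis_set n k) \<subseteq> carr (R_mu1 n k a)"
    by (rule fun_vs.span_minimal[rotated]) (auto simp: R_mu1_def bvec_def)
qed

lemma R_mu1_basis_independent: "fun_vs.independent (bvec ` basis_set n k)"
proof (rule fun_vs.independent_if_scalars_zero)
  fix g v assume *: "(\<Sum>v\<in>bvec ` basis_set n k. smul (g v) v) = 0" "v \<in> bvec ` basis_set n k"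
  then obtain c where c: "c \<in> basis_set n k" "v = bvec c" by auto
  have "0 = (\<Sum>b\<in>basis_set n k. smul (g (bvec b)) (bvec b)) c"
    using * by (simp add: sum.reindex inj_on_subset[OF inj_bvec])
  also have "\<dots> = (\<Sum>b\<in>basis_set n k. if c = b then g (bvec b) else 0)"
    unfolding sum_fun_at smul_at by (intro sum.cong refl) (simp add: bvec_at)
  also have "\<dots> = g v" using c by simp
  finally show "g v = 0" by simp
qed auto

lemma R_mu1_table:
  assumes "b \<in> basis_set n k" "b' \<in> basis_set n k"
  shows "brk (R_mu1 n k a) (bvec b) (bvec b') = mult_table n k a b b'"
proof -
  have "brk (R_mu1 n k a) (bvec b) (bvec b') =
      (\<Sum>c\<in>basis_set n k. \<Sum>c'\<in>basis_set n k. if b = c \<and> b' = c' then mult_table n k a c c' else 0)"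
    unfolding R_mu1_def bracket_algebra.simps
    by (intro sum.cong refl) (auto simp: bvec_at smul_def fun_eq_iff)
  also have "\<dots> = (\<Sum>c\<in>basis_set n k. if b = c then mult_table n k a c b' else 0)"
    using assms by (intro sum.cong) auto
  also have "\<dots> = mult_table n k a b b'"
    using assms by simp
  finally show ?thesis .
qed

lemma R_mu1_brk_linear:
  "brk (R_mu1 n k a) (u + v) w = brk (R_mu1 n k a) u w + brk (R_mu1 n k a) v w"
  "brk (R_mu1 n k a) (smul c u) w = smul c (brk (R_mu1 n k a) u w)"
  "brk (R_mu1 n k a) u (v + w) = brk (R_mu1 n k a) u v + brk (R_mu1 n k a) u w"
  "brk (R_mu1 n k a) u (smul c w) = smul c (brk (R_mu1 n k a) u w)"
  by (simp_all add: R_mu1_def fun_eq_iff sum_fun_at smul_at algebra_simps sum.distrib sum_distrib_left)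

lemma R_mu1_subspace: "fun_vs.subspace (carr (R_mu1 n k a))"
  by (simp add: R_mu1_carr_span)

lemma mult_table_in_carr:
  assumes "n - 2*k \<ge> 4" "b \<in> basis_set n k" "b' \<in> basis_set n k"
  shows "mult_table n k a b b' \<in> carr (R_mu1 n k a)"
proof -
  note [intro!] = fun_vs.subspace_0[OF R_mu1_subspace] fun_vs.subspace_add[OF R_mu1_subspace]
    fun_vs.subspace_diff[OF R_mu1_subspace] fun_vs.subspace_neg[OF R_mu1_subspace]
    fun_vs.subspace_scale[OF R_mu1_subspace] fun_vs.subspace_sum[OF R_mu1_subspace]
  have [intro!]: "bvec c \<in> carr (R_mu1 n k a)" if "c \<in> basis_set n k" for c
    using that unfolding R_mu1_carr_span by (intro fun_vs.span_base) auto
  have [simp]: "E i \<in> basis_set n k \<longleftrightarrow> 1 \<le> i \<and> i \<le> n - 2*k"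
    "F i \<in> basis_set n k \<longleftrightarrow> 1 \<le> i \<and> i \<le> 2*k" "X \<in> basis_set n k" for i
    by (auto simp: basis_set_def)
  show ?thesis
    using assms by (cases b; cases b') auto
qed

lemma R_mu1_brk_in_carr:
  assumes "n - 2*k \<ge> 4"
  shows "brk (R_mu1 n k a) u v \<in> carr (R_mu1 n k a)"
proof -
  have "brk (R_mu1 n k a) u v =
    (\<Sum>b\<in>basis_set n k. \<Sum>b'\<in>basis_set n k. smul (u b * v b') (mult_table n k a b b'))"
    by (simp add: R_mu1_def)
  also have "\<dots> \<in> carr (R_mu1 n k a)"
    by (intro fun_vs.subspace_sum[OF R_mu1_subspace] fun_vs.subspace_scale[OF R_mu1_subspace]
        mult_table_in_carr assms)
  finally show ?thesis .
qed

lemma R_mu1_leibniz_basis: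
  fixes a :: "nat \<Rightarrow> complex"
  assumes "k \<ge> 1" "n - 2*k \<ge> 4"
    and b: "b \<in> basis_set n k" "c \<in> basis_set n k" "d \<in> basis_set n k"
  defines "br \<equiv> brk (R_mu1 n k a)"
  shows "br (bvec b) (br (bvec c) (bvec d)) =
    br (br (bvec b) (bvec c)) (bvec d) - br (br (bvec b) (bvec d)) (bvec c)"
proof -
  define m where "m = n - 2*k"
  have m: "m \<ge> 4" "n - 2*k = m" using assms by (auto simp: m_def)
  have lin: "Vector_Spaces.linear smul smul (\<lambda>u. br u w)" "Vector_Spaces.linear smul smul (br w)" for w
    by (auto simp: br_def Vector_Spaces.linear_iff R_mu1_brk_linear fun_vs.vector_space_axioms)
  interpret l: Vector_Spaces.linear smul smul "\<lambda>u. br u w" for w by (rule lin)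
  interpret r: Vector_Spaces.linear smul smul "br w" for w by (rule lin)
  note [simp] = l.add l.scale l.neg l.diff l.sum l.zero r.add r.scale r.neg r.diff r.sum r.zero
  have mem [simp]: "E i \<in> basis_set n k \<longleftrightarrow> 1 \<le> i \<and> i \<le> m"
    "F i \<in> basis_set n k \<longleftrightarrow> 1 \<le> i \<and> i \<le> 2*k" "X \<in> basis_set n k" for i
    by (auto simp: basis_set_def m_def)
  have tab: "br (bvec b) (bvec b') = mult_table n k a b b'"
    if "b \<in> basis_set n k" "b' \<in> basis_set n k" for b b'
    unfolding br_def by (rule R_mu1_table[OF that])
  have EE: "br (bvec (E i)) (bvec (E j)) = (if i \<le> m - 1 \<and> j = 1 then bvec (E (i + 1)) else 0)"
    if "1 \<le> i" "i \<le> m" "1 \<le> j" "j \<le> m" for i j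
    using that m by (simp add: tab)
  define T where "T i = (\<Sum>j=i+1..m. smul (a (j - i + 1)) (bvec (E j)))" for i
  have EX: "br (bvec (E i)) (bvec X) = T i" if "1 \<le> i" "i \<le> m" for i
    using that m by (simp add: tab T_def)
  have EF: "br (bvec (E i)) (bvec (F j)) = (if i = 1 \<and> j \<le> k then bvec (F (k + j)) else 0)"
    if "1 \<le> i" "i \<le> m" "1 \<le> j" "j \<le> 2*k" for i j
    using that by (simp add: tab)
  have XX: "br (bvec X) (bvec X) = smul (a (m + 1)) (bvec (E m))"
    using m by (simp add: tab)
  have FX: "br (bvec (F i)) (bvec X) =
      (if i = k \<or> i = 2*k then bvec (F i) else bvec (F i) + bvec (F (i + 1)))"
    if "1 \<le> i" "i \<le> 2*k" for i
    using that assms(1) by (auto simp: tab)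
  have XF: "br (bvec X) (bvec (F i)) = 
      (if i < k then - bvec (F i) - bvec (F (i + 1)) else if i = k then - bvec (F i) else 0)"
    if "1 \<le> i" "i \<le> 2*k" for i
    using that assms(1) by (auto simp: tab)
  have TE1: "br (T i) (bvec (E (Suc 0))) = (if i \<le> m - 1 then T (Suc i) else 0)" if i: "1 \<le> i" "i \<le> m" for i
  proof (cases "i \<le> m - 1")
    case True
    have "br (T i) (bvec (E (Suc 0))) =
       (\<Sum>j=i+1..m. smul (a (j - i + 1)) (if j \<le> m - 1 then bvec (E (j + 1)) else 0))"
      unfolding T_def l.sum l.scale using i m by (intro sum.cong refl) (simp add: EE)
    also have "\<dots> = (\<Sum>j=i+1..m-1. smul (a (j - i + 1)) (bvec (E (j + 1))))"
      using i m by (intro sum.mono_neutral_cong_right) auto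
    also have "\<dots> = (\<Sum>j=i+1+1..m-1+1. smul (a (j - (i + 1) + 1)) (bvec (E j)))"
      by (subst sum.shift_bounds_cl_nat_ivl) (intro sum.cong refl, simp)
    also have "\<dots> = T (Suc i)"
      using i m True by (simp add: T_def)
    finally show ?thesis using True by simp
  next
    case False
    thus ?thesis using i by (simp add: T_def)
  qed
  have Z1: "br (bvec (F i)) (bvec (E j)) = 0" if "1 \<le> i" "i \<le> 2*k" "1 \<le> j" "j \<le> m" for i j
    using that by (simp add: tab)
  have Z2: "br (bvec (F i)) (bvec (F j)) = 0" if "1 \<le> i" "i \<le> 2*k" "1 \<le> j" "j \<le> 2*k" for i j
    using that by (simp add: tab)
  have Z3: "br (bvec X) (bvec (E j)) = 0" if "1 \<le> j" "j \<le> m" for j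
    using that by (simp add: tab)
  have ET: "br (bvec (E l)) (T i) = 0" if "1 \<le> i" "1 \<le> l" "l \<le> m" for i l
    unfolding T_def r.sum r.scale using that m by (intro sum.neutral) (simp add: EE)
  have TF: "br (T i) (bvec (F p)) = 0" if "1 \<le> i" "1 \<le> p" "p \<le> 2*k" for i p
    unfolding T_def l.sum l.scale using that m by (intro sum.neutral) (simp add: EF)
  have TE: "br (T i) (bvec (E q)) = 0" if "1 \<le> i" "2 \<le> q" "q \<le> m" for i q
    unfolding T_def l.sum l.scale using that m by (intro sum.neutral) (simp add: EE)
  have FT: "br (bvec (F p)) (T i) = 0" if "1 \<le> i" "1 \<le> p" "p \<le> 2*k" for i p
    unfolding T_def r.sum r.scale using that m by (intro sum.neutral) (simp add: Z1)
  have XT: "br (bvec X) (T i) = 0" if "1 \<le> i" for i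
    unfolding T_def r.sum r.scale using that m by (intro sum.neutral) (simp add: Z3)
  have cases: thesis if "b \<in> basis_set n k" "\<And>i. b = E i \<Longrightarrow> 1 \<le> i \<Longrightarrow> i \<le> m \<Longrightarrow> thesis"
     "\<And>i. b = F i \<Longrightarrow> 1 \<le> i \<Longrightarrow> i \<le> 2*k \<Longrightarrow> thesis" "b = X \<Longrightarrow> thesis" for b thesis
    using that by (cases b) auto
  note rules = EE EF EX XX FX XF Z1 Z2 Z3 TE1 ET TF FT XT
  from b(1) show ?thesis
  proof (rule cases)
    fix i assume i: "b = E i" "1 \<le> i" "i \<le> m"
    from b(2) show ?thesis
    proof (rule cases)
      fix j assume j: "c = E j" "1 \<le> j" "j \<le> m"
      have "j = 1 \<or> 2 \<le> j" using j by auto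
      with b(3) show ?thesis using i j m assms(1)
        by (elim cases disjE) (auto simp: rules TE)
    next
      fix j assume j: "c = F j" "1 \<le> j" "j \<le> 2*k"
      from b(3) show ?thesis
        by (rule cases) (use i j m assms(1) in \<open>auto simp: rules\<close>)
    next
      assume c: "c = X"
      from b(3) show ?thesis
      proof (rule cases)
        fix l assume l: "d = E l" "1 \<le> l" "l \<le> m"
        hence "l = 1 \<or> 2 \<le> l" by auto
        thus ?thesis using i l c m assms(1)
          by (elim disjE) (auto simp: rules TE)
      qed (use i c m assms(1) in \<open>auto simp: rules\<close>)
    qed
  next
    fix i assume i: "b = F i" "1 \<le> i" "i \<le> 2*k"
    from b(2,3) show ?thesis
      by (elim cases) (use i m assms(1) in \<open>auto simp: rules\<close>)
  next
    assume i: "b = X"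
    from b(2,3) show ?thesis
      by (elim cases) (use i m assms(1) in \<open>auto simp: rules\<close>)
  qed
qed

lemma R_mu1_leibniz_algebra:
  assumes "k \<ge> 1" "n - 2*k \<ge> 4"
  shows "leibniz_algebra (R_mu1 n k a)"
proof -
  define br where "br = brk (R_mu1 n k a)"
  define B where "B = bvec ` basis_set n k"
  interpret p: vector_space_pair smul smul ..
  have lin: "Vector_Spaces.linear smul smul (\<lambda>u. br u w)" "Vector_Spaces.linear smul smul (br w)" for w
    by (auto simp: br_def Vector_Spaces.linear_iff R_mu1_brk_linear fun_vs.vector_space_axioms)
  note L = R_mu1_brk_linear[of n k a, folded br_def]
  have 1: "br u (br v w) = br (br u v) w - br (br u w) v"
    if "u \<in> B" "v \<in> B" "w \<in> B" for u v w
    using that R_mu1_leibniz_basis[OF assms, where a = a] unfolding br_def B_def by blast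
  have 2: "br u (br v w) = br (br u v) w - br (br u w) v"
    if "u \<in> fun_vs.span B" "v \<in> B" "w \<in> B" for u v w
    by (rule p.linear_eq_on[OF _ _ that(1) 1[OF _ that(2,3)]])
       (auto simp: Vector_Spaces.linear_iff L fun_vs.vector_space_axioms fun_vs.scale_right_diff_distrib)
  have 3: "br u (br v w) = br (br u v) w - br (br u w) v"
    if "u \<in> fun_vs.span B" "v \<in> fun_vs.span B" "w \<in> B" for u v w
    by (rule p.linear_eq_on[OF _ _ that(2) 2[OF that(1) _ that(3)]])
       (auto simp: Vector_Spaces.linear_iff L fun_vs.vector_space_axioms fun_vs.scale_right_diff_distrib)
  have 4: "br u (br v w) = br (br u v) w - br (br u w) v"
    if "u \<in> fun_vs.span B" "v \<in> fun_vs.span B" "w \<in> fun_vs.span B" for u v w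
    by (rule p.linear_eq_on[OF _ _ that(3) 3[OF that(1,2)]])
       (auto simp: Vector_Spaces.linear_iff L fun_vs.vector_space_axioms fun_vs.scale_right_diff_distrib)
  have "scl (R_mu1 n k a) = smul" by (simp add: R_mu1_def)
  thus ?thesis
    unfolding leibniz_algebra_def bilinear_bracket_def
    using 4 R_mu1_subspace[of n k a] R_mu1_brk_in_carr[OF assms(2)]
    by (auto simp: R_mu1_brk_linear fun_vs.vector_space_axioms R_mu1_carr_span B_def br_def)
qed

end

theory Submission
  imports Defs "HOL-Computational_Algebra.Formal_Power_Series"
begin

text \<open>
  Write \<open>m = n - 2 * k\<close>. The span of the \<open>f\<^sub>i\<close> is an ideal, and modulo it the algebra has a simple
  model: identify \<open>e\<^sub>i\<close> with \<open>t ^ (i - 1)\<close> in the truncated polynomials modulo \<open>t ^ m\<close>. Right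
  multiplication by \<open>v\<close> is then multiplication by \<open>v\<^sub>1 t + v\<^sub>x \<alpha>(t)\<close>, where \<open>v\<^sub>1\<close> and \<open>v\<^sub>x\<close> are the
  coefficients of \<open>v\<close> at \<open>e\<^sub>1\<close> and \<open>x\<close> and \<open>\<alpha>(t) = a\<^sub>2 t + a\<^sub>3 t\<^sup>2 + \<dots>\<close>; the only further term,
  coming from \<open>[x,x]\<close>, lies in degree \<open>m - 1\<close> (lemma \<open>e_series_brk\<close>).

  Let \<open>\<phi>\<close> be an isomorphism from the algebra of \<open>a'\<close> to that of \<open>a\<close>. The eigenvalues of right
  multiplication by \<open>v\<close> force \<open>\<phi>\<close> to preserve the coefficient at \<open>x\<close> (lemma \<open>iso_X_coeff\<close>). Hence
  \<open>\<phi>(e\<^sub>1)\<close> has no \<open>x\<close>-component. Let \<open>p(t)\<close> be the image of \<open>\<phi>(e\<^sub>1)\<close> in the model and \<open>A = p(0)\<close>.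
  Multiplying repeatedly by \<open>\<phi>(e\<^sub>1)\<close> on the right shows that \<open>\<phi>(e\<^sub>i)\<close> becomes \<open>(A t) ^ (i - 1) p(t)\<close>,
  and injectivity of \<open>\<phi>\<close> gives \<open>A \<noteq> 0\<close>, so that \<open>p\<close> is a unit. Three products now finish the
  argument. From \<open>[x,e\<^sub>1] = 0\<close> the \<open>e\<close>-part of \<open>\<phi>(x)\<close> is a multiple of \<open>t ^ (m - 1)\<close>. From
  \<open>[e\<^sub>1,x] = \<alpha>'(t)\<close> one gets \<open>p(t) \<alpha>(t) = \<alpha>'(A t) p(t)\<close>, and cancelling \<open>p\<close> gives
  \<open>a\<^sub>i = A ^ (i - 1) a'\<^sub>i\<close> for \<open>i \<le> m\<close>. Finally \<open>[x,x]\<close> gives the relation for \<open>i = m + 1\<close>.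

  Conversely, if the parameters are related in this way, the diagonal map \<open>e\<^sub>i \<mapsto> A ^ i e\<^sub>i\<close>, \<open>f\<^sub>i \<mapsto> f\<^sub>i\<close>,
  \<open>f\<^bsub>k+i\<^esub> \<mapsto> A f\<^bsub>k+i\<^esub>\<close> (for \<open>i \<le> k\<close>), \<open>x \<mapsto> x\<close> is an isomorphism (lemma \<open>rescaled_imp_iso\<close>).
\<close>

section \<open>The bracket in coordinates\<close>

lemma basis_set_simps [simp]:
  "E i \<in> basis_set n k \<longleftrightarrow> 1 \<le> i \<and> i \<le> n - 2*k"
  "F i \<in> basis_set n k \<longleftrightarrow> 1 \<le> i \<and> i \<le> 2*k"
  "X \<in> basis_set n k"
  by (auto simp: basis_set_def)

lemma in_carr_iff: "v \<in> carr (R_mu1 n k a) \<longleftrightarrow> (\<forall>b. b \<notin> basis_set n k \<longrightarrow> v b = 0)"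
  by (simp add: R_mu1_def)

lemma scl_R_mu1 [simp]: "scl (R_mu1 n k a) = smul"
  by (simp add: R_mu1_def)

lemma bvec_in_carr [simp]: "bvec b \<in> carr (R_mu1 n k a) \<longleftrightarrow> b \<in> basis_set n k"
  by (auto simp: in_carr_iff bvec_at)

lemma carr_eqI:
  assumes "u \<in> carr (R_mu1 n k a)" "v \<in> carr (R_mu1 n k a)"
    and "\<And>j. j < n - 2*k \<Longrightarrow> u (E (Suc j)) = v (E (Suc j))"
    and "\<And>j. 1 \<le> j \<Longrightarrow> j \<le> 2*k \<Longrightarrow> u (F j) = v (F j)"
    and "u X = v X"
  shows "u = v"
proof
  fix c
  show "u c = v c"
  proof (cases "c \<in> basis_set n k")
    case False
    thus ?thesis using assms(1,2) by (simp add: in_carr_iff)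
  next
    case True
    thus ?thesis
    proof (cases c)
      case (E i)
      thus ?thesis using True assms(3)[of "i - 1"] by auto
    qed (use True assms(4,5) in auto)
  qed
qed

lemma sum_basis_set:
  "(\<Sum>b\<in>basis_set n k. g b) =
     (\<Sum>i=1..n - 2*k. g (E i)) + (\<Sum>i=1..2*k. g (F i)) + g X"
proof -
  have "(\<Sum>b\<in>basis_set n k. g b) =
      (\<Sum>b\<in>E ` {1..n - 2*k}. g b) + (\<Sum>b\<in>F ` {1..2*k}. g b) + g X"
    unfolding basis_set_def by (subst sum.union_disjoint; (subst sum.union_disjoint)?) auto
  thus ?thesis by (simp add: sum.reindex inj_on_def)
qed

lemma brk_at:
  "brk (R_mu1 n k a) u v c =
     (\<Sum>b\<in>basis_set n k. \<Sum>b'\<in>basis_set n k. u b * v b' * mult_table n k a b b' c)"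
  by (simp add: R_mu1_def sum_fun_at smul_at)

lemma brk_by_rows:
  "brk (R_mu1 n k a) u v c =
     (\<Sum>i=1..n - 2*k. \<Sum>b'\<in>basis_set n k. u (E i) * v b' * mult_table n k a (E i) b' c) +
     (\<Sum>i=1..2*k. \<Sum>b'\<in>basis_set n k. u (F i) * v b' * mult_table n k a (F i) b' c) +
     (\<Sum>b'\<in>basis_set n k. u X * v b' * mult_table n k a X b' c)"
  unfolding brk_at by (rule sum_basis_set)

lemma brk_X_coeff: "brk (R_mu1 n k a) u v X = 0"
proof -
  have "mult_table n k a b b' X = 0" for b b'
    by (cases b; cases b') (auto simp: bvec_at sum_fun_at smul_at)
  thus ?thesis by (simp add: brk_at)
qed

text \<open>
  The image of a vector in the model: \<open>e\<^sub>i\<close> becomes \<open>t ^ (i - 1)\<close>. In untruncated power series a series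
  with nonzero constant term has an honest inverse; truncation enters through divisibility by
  \<open>t ^ m\<close>.
\<close>

definition e_series :: "(basis_index \<Rightarrow> complex) \<Rightarrow> complex fps" where
  "e_series u = Abs_fps (\<lambda>i. u (E (Suc i)))"

text \<open>
  The series \<open>v\<^sub>1 t + v\<^sub>x (a\<^sub>2 t + a\<^sub>3 t\<^sup>2 + \<dots>)\<close> by which \<open>v\<close> acts from the right.
\<close>

definition right_factor :: "(nat \<Rightarrow> complex) \<Rightarrow> (basis_index \<Rightarrow> complex) \<Rightarrow> complex fps" where
  "right_factor a v =
     fps_const (v (E 1)) * fps_X + fps_const (v X) * Abs_fps (\<lambda>i. if i = 0 then 0 else a (Suc i))"

lemma e_series_nth [simp]: "fps_nth (e_series u) i = u (E (Suc i))"
  by (simp add: e_series_def)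

lemma right_factor_nth:
  "fps_nth (right_factor a v) i =
     (if i = 0 then 0 else (if i = 1 then v (E 1) else 0) + v X * a (Suc i))"
  by (simp add: right_factor_def)

text \<open>
  The coefficient \<open>a\<^bsub>j-i+1\<^esub>\<close> of \<open>e\<^sub>j\<close> in \<open>[e\<^sub>i,x]\<close> depends only on the difference \<open>j - i\<close>, so the
  \<open>e\<close>-part of the bracket is a convolution, that is, a product of power series.
\<close>

lemma brk_E_coeff:
  assumes "n - 2*k \<ge> 2" "j < n - 2*k"
  shows "brk (R_mu1 n k a) u v (E (Suc j)) =
    fps_nth (e_series u * right_factor a v) j +
    (if Suc j = n - 2*k then u X * v X * a (n - 2*k + 1) else 0)"
proof -
  define m where "m = n - 2*k"
  have m: "m \<ge> 2" "n - 2*k = m" "j < m" using assms by (auto simp: m_def)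
  have EE: "(\<Sum>l=1..m. v (E l) * mult_table n k a (E i) (E l) (E (Suc j))) =
      (if i = j then v (E 1) else 0)" if "1 \<le> i" for i
  proof -
    have "(\<Sum>l=1..m. v (E l) * mult_table n k a (E i) (E l) (E (Suc j))) =
        (\<Sum>l=1..m. if l = 1 then (if i = j then v (E 1) else 0) else 0)"
      using m that by (intro sum.cong refl) (auto simp: bvec_at)
    thus ?thesis using m by simp
  qed
  have EX: "mult_table n k a (E i) X (E (Suc j)) = (if i \<le> j then a (Suc j - i + 1) else 0)"
    if "1 \<le> i" "i \<le> m" for i
  proof -
    have "mult_table n k a (E i) X (E (Suc j)) =
        (\<Sum>l=i+1..m. a (l - i + 1) * (if Suc j = l then 1 else 0))"
      using that m(2) by (simp add: sum_fun_at smul_at bvec_at)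
    also have "\<dots> = (\<Sum>l=i+1..m. if l = Suc j then a (Suc j - i + 1) else 0)"
      by (intro sum.cong) auto
    finally show ?thesis using m(3) that by simp
  qed
  have EF: "mult_table n k a (E i) (F l) (E (Suc j)) = 0" for i l
    by (simp add: bvec_at)
  have row: "(\<Sum>b'\<in>basis_set n k. u (E i) * v b' * mult_table n k a (E i) b' (E (Suc j))) =
     (if i \<le> j then u (E i) * fps_nth (right_factor a v) (Suc j - i) else 0)"
    if i: "i \<in> {1..m}" for i
  proof -
    have "(\<Sum>b'\<in>basis_set n k. u (E i) * v b' * mult_table n k a (E i) b' (E (Suc j))) =
       u (E i) * (\<Sum>b'\<in>basis_set n k. v b' * mult_table n k a (E i) b' (E (Suc j)))"
      by (simp add: sum_distrib_left mult.assoc)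
    also have "(\<Sum>b'\<in>basis_set n k. v b' * mult_table n k a (E i) b' (E (Suc j))) =
        (if i = j then v (E 1) else 0) + v X * (if i \<le> j then a (Suc j - i + 1) else 0)"
      unfolding sum_basis_set m(2) EF using i EE[of i] EX[of i]
      by (simp del: mult_table.simps)
    finally show ?thesis
      using i by (auto simp: right_factor_nth algebra_simps)
  qed
  have rowF: "mult_table n k a (F i) b' (E (Suc j)) = 0" for i b'
    by (cases b') (auto simp: bvec_at)
  have XF: "mult_table n k a X (F l) (E (Suc j)) = 0" for l
    by (auto simp: bvec_at)
  have rowX: "(\<Sum>b'\<in>basis_set n k. u X * v b' * mult_table n k a X b' (E (Suc j))) =
     (if Suc j = m then u X * v X * a (m + 1) else 0)"
    unfolding sum_basis_set m(2) XF by (simp add: bvec_at smul_at m(2))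
  have "brk (R_mu1 n k a) u v (E (Suc j)) =
     (\<Sum>i=1..m. if i \<le> j then u (E i) * fps_nth (right_factor a v) (Suc j - i) else 0) +
     (if Suc j = m then u X * v X * a (m + 1) else 0)"
    unfolding brk_by_rows m(2) rowX by (simp add: row rowF del: mult_table.simps)
  also have "(\<Sum>i=1..m. if i \<le> j then u (E i) * fps_nth (right_factor a v) (Suc j - i) else 0) =
      (\<Sum>i=1..Suc j. u (E i) * fps_nth (right_factor a v) (Suc j - i))"
    using m by (intro sum.mono_neutral_cong) (auto simp: right_factor_nth not_le le_Suc_eq)
  also have "\<dots> = fps_nth (e_series u * right_factor a v) j"
    unfolding fps_mult_nth One_nat_def sum.atLeast1_atMost_eq atLeast0AtMost lessThan_Suc_atMost
    by simp
  finally show ?thesis by (simp add: m(2))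
qed

text \<open>
  The restriction \<open>u\<^sub>x = 0\<close> removes the products \<open>[x,f\<^sub>i]\<close>. What remains is right multiplication by
  \<open>x\<close>, which acts on the \<open>f\<^sub>i\<close> by two Jordan blocks with eigenvalue \<open>1\<close>, and the products \<open>[e\<^sub>1,f\<^sub>i]\<close>.
\<close>

lemma brk_F_coeff:
  assumes "k \<ge> 1" "n - 2*k \<ge> 1" "1 \<le> j" "j \<le> 2*k" "u X = 0"
  shows "brk (R_mu1 n k a) u v (F j) =
    (if j > k then u (E 1) * v (F (j - k)) else 0) +
    v X * (u (F j) + (if j = 1 \<or> j = k + 1 then 0 else u (F (j - 1))))"
proof -
  define m where "m = n - 2*k"
  have m: "m \<ge> 1" "n - 2*k = m" using assms by (auto simp: m_def)
  have EX: "mult_table n k a (E i) X (F j) = 0" for i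
    by (simp add: sum_fun_at smul_at bvec_at)
  have EE: "mult_table n k a (E i) (E l) (F j) = 0" for i l
    by (simp add: bvec_at)
  have EF: "(\<Sum>l=1..2*k. v (F l) * mult_table n k a (E i) (F l) (F j)) =
      (if i = 1 then if j > k then v (F (j - k)) else 0 else 0)" for i
  proof -
    have "(\<Sum>l=1..2*k. v (F l) * mult_table n k a (E i) (F l) (F j)) =
        (\<Sum>l=1..2*k. if l = j - k then if i = 1 \<and> j > k then v (F (j - k)) else 0 else 0)"
      using assms by (intro sum.cong refl) (auto simp: bvec_at)
    thus ?thesis using assms by auto
  qed
  have rowE: "(\<Sum>b'\<in>basis_set n k. u (E i) * v b' * mult_table n k a (E i) b' (F j)) =
     (if i = 1 then if j > k then u (E 1) * v (F (j - k)) else 0 else 0)" for i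
  proof -
    have "(\<Sum>b'\<in>basis_set n k. u (E i) * v b' * mult_table n k a (E i) b' (F j)) =
       u (E i) * (\<Sum>b'\<in>basis_set n k. v b' * mult_table n k a (E i) b' (F j))"
      by (simp add: sum_distrib_left mult.assoc)
    also have "(\<Sum>b'\<in>basis_set n k. v b' * mult_table n k a (E i) b' (F j)) =
        (if i = 1 then if j > k then v (F (j - k)) else 0 else 0)"
      unfolding sum_basis_set EX EF EE by simp
    finally show ?thesis by auto
  qed
  have FX: "mult_table n k a (F i) X (F j) =
      (if i = j then 1 else 0) + (if i = j - 1 then if j = 1 \<or> j = k + 1 then 0 else 1 else 0)"
    if "1 \<le> i" "i \<le> 2*k" for i
    using that assms by (auto simp: bvec_at)
  have rowF: "(\<Sum>b'\<in>basis_set n k. u (F i) * v b' * mult_table n k a (F i) b' (F j)) =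
     (if i = j then v X * u (F j) else 0) +
     (if i = j - 1 then v X * (if j = 1 \<or> j = k + 1 then 0 else u (F (j - 1))) else 0)"
    if "i \<in> {1..2*k}" for i
    unfolding sum_basis_set using that FX[of i] by (simp del: mult_table.simps(4))
  have "brk (R_mu1 n k a) u v (F j) =
     (\<Sum>i=1..m. if i = 1 then if j > k then u (E 1) * v (F (j - k)) else 0 else 0) +
     (\<Sum>i=1..2*k. (if i = j then v X * u (F j) else 0) +
     (if i = j - 1 then v X * (if j = 1 \<or> j = k + 1 then 0 else u (F (j - 1))) else 0))"
    unfolding brk_by_rows m(2) rowE assms(5)
    by (subst sum.cong[OF refl rowF]) simp_all
  also have "\<dots> = (if j > k then u (E 1) * v (F (j - k)) else 0) +
    v X * (u (F j) + (if j = 1 \<or> j = k + 1 then 0 else u (F (j - 1))))"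
    using assms m by (auto simp: sum.distrib algebra_simps)
  finally show ?thesis .
qed

section \<open>Truncated power series\<close>

lemma fps_X_power_dvd_iff:
  "fps_X ^ m dvd (f :: 'a::field fps) \<longleftrightarrow> (\<forall>j<m. fps_nth f j = 0)"
proof
  assume "fps_X ^ m dvd f"
  then obtain g where "f = fps_X ^ m * g" ..
  thus "\<forall>j<m. fps_nth f j = 0" by (simp add: fps_X_power_mult_nth)
next
  assume "\<forall>j<m. fps_nth f j = 0"
  hence "fps_cutoff m f = 0" by (simp add: fps_eq_iff)
  hence "fps_shift m f * fps_X ^ m = f" using fps_shift_cutoff[of m f] by simp
  thus "fps_X ^ m dvd f" by (metis dvd_triv_right)
qed

lemma e_series_brk:
  assumes "n - 2*k \<ge> 2"
  shows "fps_X ^ (n - 2*k) dvd e_series (brk (R_mu1 n k a) u v) -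
    (e_series u * right_factor a v +
     fps_const (u X * v X * a (n - 2*k + 1)) * fps_X ^ (n - 2*k - 1))"
  unfolding fps_X_power_dvd_iff using assms
  by (auto simp: brk_E_coeff fps_X_power_nth)

section \<open>Invariants of an isomorphism\<close>

lemma iso_bij_betw:
  "algebra_iso \<phi> (R_mu1 n k a') (R_mu1 n k a) \<Longrightarrow>
    bij_betw \<phi> (carr (R_mu1 n k a')) (carr (R_mu1 n k a))"
  by (simp add: algebra_iso_def)

lemma iso_add:
  "algebra_iso \<phi> (R_mu1 n k a') (R_mu1 n k a) \<Longrightarrow>
    u \<in> carr (R_mu1 n k a') \<Longrightarrow> v \<in> carr (R_mu1 n k a') \<Longrightarrow> \<phi> (u + v) = \<phi> u + \<phi> v"
  by (simp add: algebra_iso_def)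

lemma iso_smul:
  "algebra_iso \<phi> (R_mu1 n k a') (R_mu1 n k a) \<Longrightarrow> u \<in> carr (R_mu1 n k a') \<Longrightarrow>
    \<phi> (smul c u) = smul c (\<phi> u)"
  by (simp add: algebra_iso_def)

lemma iso_brk:
  "algebra_iso \<phi> (R_mu1 n k a') (R_mu1 n k a) \<Longrightarrow>
    u \<in> carr (R_mu1 n k a') \<Longrightarrow> v \<in> carr (R_mu1 n k a') \<Longrightarrow>
    \<phi> (brk (R_mu1 n k a') u v) = brk (R_mu1 n k a) (\<phi> u) (\<phi> v)"
  by (simp add: algebra_iso_def)

lemma iso_zero:
  assumes "algebra_iso \<phi> (R_mu1 n k a') (R_mu1 n k a)"
  shows "\<phi> 0 = 0"
  using iso_smul[OF assms fun_vs.subspace_0[OF R_mu1_subspace], of 0] by simp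

lemma iso_sum:
  assumes "algebra_iso \<phi> (R_mu1 n k a') (R_mu1 n k a)" "\<And>i. i \<in> I \<Longrightarrow> f i \<in> carr (R_mu1 n k a')"
  shows "\<phi> (\<Sum>i\<in>I. f i) = (\<Sum>i\<in>I. \<phi> (f i))"
  using assms(2)
proof (induction I rule: infinite_finite_induct)
  case (insert i I)
  have "(\<Sum>i\<in>I. f i) \<in> carr (R_mu1 n k a')"
    using insert by (intro fun_vs.subspace_sum[OF R_mu1_subspace]) auto
  hence "\<phi> (f i + (\<Sum>i\<in>I. f i)) = \<phi> (f i) + \<phi> (\<Sum>i\<in>I. f i)"
    using insert by (intro iso_add[OF assms(1)]) auto
  moreover have "\<phi> (\<Sum>i\<in>I. f i) = (\<Sum>i\<in>I. \<phi> (f i))"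
    using insert by auto
  ultimately show ?case by (simp only: sum.insert[OF insert(1,2)])
qed (simp_all add: iso_zero[OF assms(1)])

text \<open>
  The vector \<open>f\<^bsub>2k\<^esub>\<close> is a common eigenvector of all right multiplications in the target, with
  eigenvalue \<open>u\<^sub>x\<close> for right multiplication by \<open>u\<close>. Its preimage \<open>w\<close> is therefore a common
  eigenvector in the source, with eigenvalue the \<open>x\<close>-coefficient of \<open>\<phi> u\<close>. In the source such an
  eigenvalue is read off from \<open>w\<close>: since right multiplications act nilpotently on the \<open>e\<close>-part and
  some eigenvalue is nonzero, \<open>w\<close> lies in the span of the \<open>f\<^sub>i\<close>, where right multiplication by
  \<open>u\<close> is \<open>u\<^sub>x\<close> times a unipotent map.
\<close>

lemma iso_X_coeff:
  assumes "k \<ge> 1" "n - 2*k \<ge> 4"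
    and iso: "algebra_iso \<phi> (R_mu1 n k a') (R_mu1 n k a)"
    and v: "v \<in> carr (R_mu1 n k a')"
  shows "\<phi> v X = v X"
proof -
  let ?L = "R_mu1 n k a" and ?L' = "R_mu1 n k a'"
  have surj: "\<exists>u\<in>carr ?L'. \<phi> u = y" if "y \<in> carr ?L" for y
    using iso_bij_betw[OF iso] that by (metis bij_betw_imp_surj_on imageE)
  have inj: "inj_on \<phi> (carr ?L')"
    using iso_bij_betw[OF iso] by (rule bij_betw_imp_inj_on)
  obtain w where w: "w \<in> carr ?L'" "\<phi> w = bvec (F (2*k))"
    using surj[of "bvec (F (2*k))"] assms(1) by auto
  have eigen: "brk ?L' w u = smul (\<phi> u X) w" if u: "u \<in> carr ?L'" for u
  proof -
    have "brk ?L (bvec (F (2*k))) (\<phi> u) = smul (\<phi> u X) (bvec (F (2*k)))"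
    proof (rule carr_eqI)
      show "brk ?L (bvec (F (2*k))) (\<phi> u) \<in> carr ?L"
        by (rule R_mu1_brk_in_carr[OF assms(2)])
      show "smul (\<phi> u X) (bvec (F (2*k))) \<in> carr ?L"
        using assms(1) by (intro fun_vs.subspace_scale[OF R_mu1_subspace]) simp
    next
      fix j assume "j < n - 2*k"
      moreover have "e_series (bvec (F (2*k))) = 0" by (simp add: fps_eq_iff bvec_at)
      ultimately show "brk ?L (bvec (F (2*k))) (\<phi> u) (E (Suc j)) =
          smul (\<phi> u X) (bvec (F (2*k))) (E (Suc j))"
        using assms(2) by (simp add: brk_E_coeff smul_at bvec_at)
    next
      fix j assume "1 \<le> j" "j \<le> 2*k"
      thus "brk ?L (bvec (F (2*k))) (\<phi> u) (F j) = smul (\<phi> u X) (bvec (F (2*k))) (F j)"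
        using assms by (auto simp: brk_F_coeff smul_at bvec_at)
    qed (simp add: brk_X_coeff smul_at bvec_at)
    hence "\<phi> (brk ?L' w u) = \<phi> (smul (\<phi> u X) w)"
      using iso_brk[OF iso w(1) u] iso_smul[OF iso w(1)] w(2) by (simp add: fun_eq_iff)
    thus ?thesis
      using inj R_mu1_brk_in_carr[OF assms(2)] fun_vs.subspace_scale[OF R_mu1_subspace w(1)]
      by (auto dest: inj_onD)
  qed
  \<comment> \<open>Choosing the eigenvalue \<open>1\<close> makes \<open>w\<close> itself a bracket, hence free of \<open>x\<close>.\<close>
  obtain x where x: "x \<in> carr ?L'" "\<phi> x = bvec X"
    using surj[of "bvec X"] by auto
  have fixed: "brk ?L' w x = w"
    using eigen[OF x(1)] x(2) by (simp add: bvec_at)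
  have wX: "w X = 0" using brk_X_coeff[of n k a' w x] fixed by simp
  \<comment> \<open>The right factor has no constant term, so \<open>w\<close> being fixed kills its \<open>e\<close>-part degree by degree.\<close>
  have wE: "w (E (Suc j)) = 0" for j
  proof (induction j rule: less_induct)
    case (less j)
    show ?case
    proof (cases "j < n - 2*k")
      case True
      have "w (E (Suc j)) = fps_nth (e_series w * right_factor a' x) j"
        using brk_E_coeff[of n k j a' w x] True assms(2) fixed wX by simp
      also have "\<dots> = 0"
        unfolding fps_mult_nth using less
        by (intro sum.neutral) (auto simp: right_factor_nth)
      finally show ?thesis .
    next
      case False
      thus ?thesis using w(1) by (auto simp: in_carr_iff)
    qed
  qed
  have "\<exists>j. w (F j) \<noteq> 0"
  proof (rule ccontr)
    assume *: "\<nexists>j. w (F j) \<noteq> 0"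
    have "w = 0"
      using w(1) fun_vs.subspace_0[OF R_mu1_subspace] by (rule carr_eqI) (use * wX wE in auto)
    hence "bvec (F (2*k)) (F (2*k)) = 0" using iso_zero[OF iso] w(2) by (metis zero_fun_apply)
    thus False by (simp add: bvec_at)
  qed
  \<comment> \<open>At the lowest nonzero \<open>f\<close>-coefficient the nilpotent part of the Jordan block contributes nothing.\<close>
  then obtain j where j: "w (F j) \<noteq> 0" "\<And>i. i < j \<Longrightarrow> w (F i) = 0"
    using exists_least_iff[of "\<lambda>j. w (F j) \<noteq> 0"] by blast
  have "1 \<le> j" "j \<le> 2*k" using j(1) w(1) by (auto simp: in_carr_iff intro: ccontr)
  hence "brk ?L' w v (F j) = v X * w (F j)"
    using assms wX wE[of 0] j(2)[of "j - 1"] by (simp add: brk_F_coeff)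
  thus ?thesis using eigen[OF v] j(1) by (simp add: smul_at)
qed

text \<open>
  The scalar is the \<open>e\<^sub>1\<close>-coefficient of \<open>\<phi> e\<^sub>1\<close>. In the proof \<open>y\<close> and \<open>z\<close> are the images of \<open>e\<^sub>1\<close> and
  \<open>x\<close>, and the relations among the parameters are the images of \<open>[x,e\<^sub>1]\<close>, \<open>[e\<^sub>1,x]\<close> and \<open>[x,x]\<close>.
\<close>

lemma iso_imp_rescaled:
  assumes "k \<ge> 1" "n - 2*k \<ge> 4"
    and iso: "algebra_iso \<phi> (R_mu1 n k a') (R_mu1 n k a)"
  shows "\<exists>A. A \<noteq> 0 \<and> (\<forall>i\<in>{2..n - 2*k + 1}. a' i = a i / A ^ (i - 1))"
proof -
  define m where "m = n - 2*k"
  have m: "m \<ge> 4" "n - 2*k = m" using assms by (auto simp: m_def)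
  let ?L = "R_mu1 n k a" and ?L' = "R_mu1 n k a'"
  let ?X = "fps_X :: complex fps"
  define y where "y = \<phi> (bvec (E 1))"
  define z where "z = \<phi> (bvec X)"
  define p where "p = e_series y"
  define s where "s = e_series z"
  define A where "A = y (E 1)"
  have carr [simp]: "bvec (E i) \<in> carr ?L'" if "1 \<le> i" "i \<le> m" for i
    using that m by simp
  have tab: "brk ?L' (bvec b) (bvec b') = mult_table n k a' b b'"
    if "b \<in> basis_set n k" "b' \<in> basis_set n k" for b b'
    by (rule R_mu1_table[OF that])
  have yX: "y X = 0" and zX: "z X = 1"
    using m iso_X_coeff[OF assms, of "bvec (E 1)"] iso_X_coeff[OF assms, of "bvec X"]
    by (simp_all add: y_def z_def bvec_at)
  have Ry: "right_factor a y = fps_const A * ?X"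
    by (simp add: right_factor_def yX A_def)
  note es = e_series_brk[of n k a, unfolded m(2)]
  have es0: "?X ^ m dvd e_series (brk ?L u v) - e_series u * right_factor a v"
    if "u X = 0 \<or> v X = 0" for u v
    using es[of u v] that m by auto

  have phi_E: "?X ^ m dvd e_series (\<phi> (bvec (E (Suc i)))) - (fps_const A * ?X) ^ i * p"
    if "i < m" for i
    using that
  proof (induction i)
    case 0
    thus ?case by (simp add: p_def y_def)
  next
    case (Suc i)
    let ?u = "\<phi> (bvec (E (Suc i)))"
    have "bvec (E (Suc (Suc i))) = brk ?L' (bvec (E (Suc i))) (bvec (E 1))"
      using Suc m by (subst tab) auto
    hence *: "\<phi> (bvec (E (Suc (Suc i)))) = brk ?L ?u y"
      using iso_brk[OF iso, of "bvec (E (Suc i))" "bvec (E 1)"] Suc m by (simp add: y_def)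
    have "?X ^ m dvd (e_series (brk ?L ?u y) - e_series ?u * right_factor a y)
        + (e_series ?u - (fps_const A * ?X) ^ i * p) * (fps_const A * ?X)"
      using es0[of ?u y] yX Suc by (intro dvd_add dvd_mult2) auto
    thus ?case unfolding * Ry by (simp add: algebra_simps)
  qed

  \<comment> \<open>If \<open>A = 0\<close> then \<open>\<phi> e\<^sub>2 = [\<phi> e\<^sub>1, \<phi> e\<^sub>1]\<close> would vanish, its \<open>f\<close>-part included.\<close>
  have "A \<noteq> 0"
  proof
    assume A: "A = 0"
    have y1: "y (E (Suc 0)) = 0" using A by (simp add: A_def)
    have "brk ?L y y = 0"
    proof (rule carr_eqI)
      show "brk ?L y y \<in> carr ?L" by (rule R_mu1_brk_in_carr[OF assms(2)])
      show "0 \<in> carr ?L" by (rule fun_vs.subspace_0[OF R_mu1_subspace])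
      show "brk ?L y y (E (Suc j)) = 0 (E (Suc j))" if "j < n - 2*k" for j
        using that assms(2) by (simp add: brk_E_coeff Ry A yX)
      show "brk ?L y y (F j) = 0 (F j)" if "1 \<le> j" "j \<le> 2*k" for j
        using that assms by (simp add: brk_F_coeff y1 yX)
    qed (simp add: brk_X_coeff)
    moreover have "bvec (E 2) = brk ?L' (bvec (E 1)) (bvec (E 1))"
      using m by (subst tab) (auto simp: numeral_2_eq_2)
    ultimately have "\<phi> (bvec (E 2)) = \<phi> 0"
      using iso_brk[OF iso, of "bvec (E 1)" "bvec (E 1)"] m iso_zero[OF iso] by (simp add: y_def)
    hence "bvec (E 2) = 0"
      using bij_betw_imp_inj_on[OF iso_bij_betw[OF iso]] m
        fun_vs.subspace_0[OF R_mu1_subspace, of n k a']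
      by (auto dest!: inj_onD)
    hence "bvec (E 2) (E 2) = 0" by simp
    thus False by (simp add: bvec_at)
  qed

  \<comment> \<open>From \<open>[x,e\<^sub>1] = 0\<close>: multiplication by \<open>A t\<close> annihilates the \<open>e\<close>-part of \<open>z\<close> modulo \<open>t ^ m\<close>, which
    leaves only its top coefficient.\<close>
  have sE: "z (E (Suc j)) = 0" if "Suc j < m" for j
  proof -
    have "0 = brk ?L' (bvec X) (bvec (E 1))" using m by (subst tab) auto
    hence "brk ?L z y = 0"
      using iso_brk[OF iso, of "bvec X" "bvec (E 1)"] m iso_zero[OF iso]
      by (simp add: y_def z_def)
    hence "fps_nth (e_series z * right_factor a y) (Suc j) = 0"
      using brk_E_coeff[of n k "Suc j" a z y] that m yX by (auto split: if_splits)
    thus ?thesis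
      using \<open>A \<noteq> 0\<close> unfolding Ry by (simp add: mult.left_commute[of _ "fps_const _"])
  qed

  \<comment> \<open>From \<open>[e\<^sub>1,x]\<close>: the congruence \<open>\<alpha>'(A t) p \<equiv> p (z\<^sub>1 t + \<alpha>)\<close>, in which the unit \<open>p\<close> is cancelled
    afterwards.\<close>
  have "?X ^ m dvd (\<Sum>j=2..m. fps_const (a' j) * (fps_const A * ?X) ^ (j - 1)) * p - p * right_factor a z"
  proof -
    have "brk ?L' (bvec (E 1)) (bvec X) = (\<Sum>j=2..m. smul (a' j) (bvec (E j)))"
      using m by (subst tab) (auto simp: numeral_2_eq_2 intro!: sum.cong)
    hence "brk ?L y z = \<phi> (\<Sum>j=2..m. smul (a' j) (bvec (E j)))"
      using iso_brk[OF iso, of "bvec (E 1)" "bvec X"] m by (simp add: y_def z_def)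
    also have "\<dots> = (\<Sum>j=2..m. smul (a' j) (\<phi> (bvec (E j))))"
      by (subst iso_sum[OF iso]) (auto intro!: sum.cong iso_smul[OF iso]
          fun_vs.subspace_scale[OF R_mu1_subspace] carr simp del: bvec_in_carr)
    finally have *: "e_series (brk ?L y z) = (\<Sum>j=2..m. fps_const (a' j) * e_series (\<phi> (bvec (E j))))"
      by (simp add: fps_eq_iff fps_sum_nth sum_fun_at smul_at)
    have "?X ^ m dvd (e_series (brk ?L y z) - p * right_factor a z) -
       (\<Sum>j=2..m. fps_const (a' j) * (e_series (\<phi> (bvec (E j))) - (fps_const A * ?X) ^ (j - 1) * p))"
    proof (rule dvd_diff)
      show "?X ^ m dvd e_series (brk ?L y z) - p * right_factor a z"
        using es0[of y z] yX by (simp add: p_def)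
      show "?X ^ m dvd (\<Sum>j=2..m. fps_const (a' j) *
          (e_series (\<phi> (bvec (E j))) - (fps_const A * ?X) ^ (j - 1) * p))"
      proof (intro dvd_sum dvd_mult)
        fix j assume "j \<in> {2..m}"
        hence "j - 1 < m" "Suc (j - 1) = j" by auto
        thus "?X ^ m dvd e_series (\<phi> (bvec (E j))) - (fps_const A * ?X) ^ (j - 1) * p"
          using phi_E[of "j - 1"] by metis
      qed
    qed
    also have "(e_series (brk ?L y z) - p * right_factor a z) -
       (\<Sum>j=2..m. fps_const (a' j) * (e_series (\<phi> (bvec (E j))) - (fps_const A * ?X) ^ (j - 1) * p)) =
       (\<Sum>j=2..m. fps_const (a' j) * (fps_const A * ?X) ^ (j - 1)) * p - p * right_factor a z"
      unfolding * by (simp add: right_diff_distrib sum_subtractf sum_distrib_right mult.assoc)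
    finally show ?thesis .
  qed
  hence "?X ^ m dvd ((\<Sum>j=2..m. fps_const (a' j) * (fps_const A * ?X) ^ (j - 1)) - right_factor a z) * p * inverse p"
    unfolding left_diff_distrib mult.commute[of p "right_factor a z"]
    by (simp only: dvd_mult2 flip: left_diff_distrib)
  moreover have "p * inverse p = 1"
    using \<open>A \<noteq> 0\<close> by (intro inverse_mult_eq_1') (simp add: p_def A_def)
  ultimately have low:
    "?X ^ m dvd (\<Sum>j=2..m. fps_const (a' j) * (fps_const A * ?X) ^ (j - 1)) - right_factor a z"
    by (simp add: mult.assoc)
  have 1: "a' i * A ^ (i - 1) = a i" if i: "2 \<le> i" "i \<le> m" for i
  proof -
    have "fps_nth (\<Sum>j=2..m. fps_const (a' j) * (fps_const A * ?X) ^ (j - 1)) (i - 1) =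
        fps_nth (right_factor a z) (i - 1)"
      using low i unfolding fps_X_power_dvd_iff by (auto simp: fps_sub_nth)
    also have "fps_nth (right_factor a z) (i - 1) = a i"
      using i m sE[of 0] by (simp add: right_factor_nth zX)
    also have "fps_nth (\<Sum>j=2..m. fps_const (a' j) * (fps_const A * ?X) ^ (j - 1)) (i - 1) =
        (\<Sum>j=2..m. if j = i then a' i * A ^ (i - 1) else 0)"
      unfolding fps_sum_nth power_mult_distrib fps_const_power
      using i by (intro sum.cong refl) (auto simp: fps_X_power_nth)
    finally show ?thesis using i by simp
  qed
  \<comment> \<open>From \<open>[x,x]\<close>: the \<open>e\<close>-part of \<open>z\<close> starts in degree \<open>m - 1\<close> and the right factor in degree \<open>1\<close>, so
    only the exceptional term of the bracket reaches the coefficient at \<open>e\<^sub>m\<close>.\<close>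
  have 2: "a' (m + 1) * A ^ m = a (m + 1)"
  proof -
    have "brk ?L' (bvec X) (bvec X) = smul (a' (m + 1)) (bvec (E m))"
      using m by (subst tab) auto
    hence *: "brk ?L z z = smul (a' (m + 1)) (\<phi> (bvec (E m)))"
      using iso_brk[OF iso, of "bvec X" "bvec X"] m iso_smul[OF iso, of "bvec (E m)"]
      by (simp add: z_def)
    have "m - 1 < m" "Suc (m - 1) = m" using m(1) by auto
    hence "\<phi> (bvec (E m)) (E m) = fps_nth ((fps_const A * ?X) ^ (m - 1) * p) (m - 1)"
      using phi_E[of "m - 1"] unfolding fps_X_power_dvd_iff
      by (metis e_series_nth eq_iff_diff_eq_0 fps_sub_nth)
    also have "\<dots> = A ^ (m - 1) * A"
      by (simp add: power_mult_distrib fps_const_power mult.assoc fps_X_power_mult_nth p_def A_def)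
    finally have "brk ?L z z (E m) = a' (m + 1) * A ^ m"
      using m by (simp add: * smul_at power_eq_if)
    moreover have "fps_nth (e_series z * right_factor a z) (m - 1) = 0"
      unfolding fps_mult_nth
      by (intro sum.neutral) (use sE in \<open>auto simp: right_factor_nth\<close>)
    ultimately show ?thesis
      using brk_E_coeff[of n k "m - 1" a z z] m zX by simp
  qed
  show ?thesis
  proof (intro exI[of _ A] conjI ballI)
    fix i assume "i \<in> {2..n - 2*k + 1}"
    hence "i = m + 1 \<or> 2 \<le> i \<and> i \<le> m" using m by auto
    hence "a' i * A ^ (i - 1) = a i" using 1 2 by auto
    thus "a' i = a i / A ^ (i - 1)" using \<open>A \<noteq> 0\<close> by (simp add: field_simps)
  qed fact
qed

section \<open>Rescaling the parameters\<close>

text \<open>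
  The weights \<open>\<sigma>\<close> form a grading: \<open>e\<^sub>i\<close> has degree \<open>i\<close>, \<open>x\<close> and \<open>f\<^sub>1, \<dots>, f\<^sub>k\<close> have degree \<open>0\<close>, and
  \<open>f\<^bsub>k+1\<^esub>, \<dots>, f\<^bsub>2k\<^esub>\<close> have degree \<open>1\<close> because \<open>[e\<^sub>1,f\<^sub>i] = f\<^bsub>k+i\<^esub>\<close>. Every product respects the grading
  once \<open>a\<^sub>i\<close> is given degree \<open>-(i - 1)\<close>, and this is the scaling in the hypothesis.
\<close>

lemma rescaled_imp_iso:
  assumes "k \<ge> 1" "n - 2*k \<ge> 2" and A: "A \<noteq> 0"
    and a': "\<And>i. i \<in> {2..n - 2*k + 1} \<Longrightarrow> a' i = a i / A ^ (i - 1)"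
  shows "isomorphic_algebras (R_mu1 n k a') (R_mu1 n k a)"
proof -
  define m where "m = n - 2*k"
  have m: "m \<ge> 2" "n - 2*k = m" using assms by (auto simp: m_def)
  define \<sigma> where "\<sigma> b = (case b of E i \<Rightarrow> A ^ i | F i \<Rightarrow> if i \<le> k then 1 else A | X \<Rightarrow> 1)" for b
  define \<phi> where "\<phi> v = (\<lambda>b. \<sigma> b * v b)" for v :: "basis_index \<Rightarrow> complex"
  have nz: "\<sigma> b \<noteq> 0" for b using A by (simp add: \<sigma>_def split: basis_index.split)
  have a_eq: "a i = a' i * A ^ (i - 1)" if "2 \<le> i" "i \<le> m + 1" for i
    using a'[of i] that m A by (simp add: field_simps)
  have table: "\<sigma> c * mult_table n k a' b b' c = \<sigma> b * \<sigma> b' * mult_table n k a b b' c"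
    if "b \<in> basis_set n k" "b' \<in> basis_set n k" for b b' c
  proof (cases "\<exists>i. b = E i \<and> b' = X")
    case True
    then obtain i where "b = E i" "b' = X" by auto
    moreover from this have "1 \<le> i" "i \<le> m" using that m(2) by simp_all
    ultimately have i: "b = E i" "b' = X" "1 \<le> i" "i \<le> m" by blast+
    have "A ^ j * a' (j - i + 1) = A ^ i * a (j - i + 1)" if "i + 1 \<le> j" "j \<le> m" for j
      using a_eq[of "j - i + 1"] that i by (simp add: power_add[symmetric])
    hence "\<sigma> c * (a' (j - i + 1) * bvec (E j) c) = A ^ i * (a (j - i + 1) * bvec (E j) c)"
      if "j \<in> {i+1..m}" for j
      using that by (auto simp: bvec_at \<sigma>_def)
    thus ?thesis
      using i m(2) by (auto simp: sum_fun_at smul_at sum_distrib_left \<sigma>_def[of "E i"] \<sigma>_def[of X] intro!: sum.cong)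
  next
    case False
    have FX: "mult_table n k a' (F i) X = mult_table n k a (F i) X" for i
      by simp
    have XF: "mult_table n k a' X (F i) = mult_table n k a X (F i)" for i
      by simp
    show ?thesis
    proof (cases b)
      case (E i)
      with False show ?thesis
        by (cases b') (auto simp: bvec_at \<sigma>_def)
    next
      case (F i)
      show ?thesis
      proof (cases b')
        case X
        have "mult_table n k a (F i) X c = 0 \<or> \<sigma> c = \<sigma> (F i)"
          using \<open>k \<ge> 1\<close> by (auto simp: bvec_at \<sigma>_def)
        thus ?thesis using \<open>b = F i\<close> X by (auto simp del: mult_table.simps simp: FX \<sigma>_def[of X])
      qed (simp_all add: \<open>b = F i\<close>)
    next
      case X
      have "\<sigma> c * (a' (m + 1) * bvec (E m) c) = a (m + 1) * bvec (E m) c"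
        using a_eq[of "m + 1"] m(1) by (simp add: bvec_at \<sigma>_def)
      with \<open>b = X\<close> show ?thesis
      proof (cases b')
        case (F i)
        have "mult_table n k a X (F i) c = 0 \<or> \<sigma> c = \<sigma> (F i)"
          using \<open>k \<ge> 1\<close> by (auto simp: bvec_at \<sigma>_def)
        thus ?thesis using \<open>b = X\<close> F by (auto simp del: mult_table.simps simp: XF \<sigma>_def[of X])
      qed (simp_all add: smul_at m(2) \<sigma>_def[of X])
    qed
  qed
  have "algebra_iso \<phi> (R_mu1 n k a') (R_mu1 n k a)"
    unfolding algebra_iso_def
  proof (intro conjI ballI allI)
    show "bij_betw \<phi> (carr (R_mu1 n k a')) (carr (R_mu1 n k a))"
      by (rule bij_betw_byWitness[where f' = "\<lambda>v b. v b / \<sigma> b"])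
         (auto simp: \<phi>_def in_carr_iff nz)
    fix u v
    show "\<phi> (brk (R_mu1 n k a') u v) = brk (R_mu1 n k a) (\<phi> u) (\<phi> v)"
    proof
      fix c
      have "\<phi> (brk (R_mu1 n k a') u v) c = (\<Sum>b\<in>basis_set n k. \<Sum>b'\<in>basis_set n k.
          u b * v b' * (\<sigma> c * mult_table n k a' b b' c))"
        by (simp add: \<phi>_def brk_at sum_distrib_left mult_ac)
      also have "\<dots> = brk (R_mu1 n k a) (\<phi> u) (\<phi> v) c"
        unfolding brk_at \<phi>_def by (intro sum.cong refl) (simp add: table mult_ac)
      finally show "\<phi> (brk (R_mu1 n k a') u v) c = brk (R_mu1 n k a) (\<phi> u) (\<phi> v) c" .
    qed
  qed (auto simp: \<phi>_def fun_eq_iff smul_at algebra_simps)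
  thus ?thesis unfolding isomorphic_algebras_def by blast
qed

theorem proposition4p5:
  fixes n k :: nat and a a' :: "nat \<Rightarrow> complex"
  assumes "k \<ge> 1" and "n - 2*k \<ge> 4"
  shows "isomorphic_algebras (R_mu1 n k a') (R_mu1 n k a) \<longleftrightarrow>
    (\<exists>A::complex. A \<noteq> 0 \<and> (\<forall>i\<in>{2..n - 2*k + 1}. a' i = a i / A ^ (i - 1)))"
proof
  assume "isomorphic_algebras (R_mu1 n k a') (R_mu1 n k a)"
  thus "\<exists>A. A \<noteq> 0 \<and> (\<forall>i\<in>{2..n - 2*k + 1}. a' i = a i / A ^ (i - 1))"
    unfolding isomorphic_algebras_def using iso_imp_rescaled[OF assms] by blast
next
  assume "\<exists>A. A \<noteq> 0 \<and> (\<forall>i\<in>{2..n - 2*k + 1}. a' i = a i / A ^ (i - 1))"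
  thus "isomorphic_algebras (R_mu1 n k a') (R_mu1 n k a)"
    using assms rescaled_imp_iso[of k n] by auto
qed

end
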